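(* Let $n,m\ge 2$ be integers, and regard $C_{2n}\times C_{2m}$ as a subgraph of $M(C_{2n})\times M(C_{2m})$ (via the natural inclusion of $C_{2n}$ into $M(C_{2n})$ and of $C_{2m}$ into $M(C_{2m})$, whose original vertices are kept). If $(u,v)$ is a vertex of $M(C_{2n})\times M(C_{2m})$ with $(u,v)\notin V(C_{2n}\times C_{2m})$, then $$f\big(M(C_{2n})\times M(C_{2m}),(u,v)\big)\le f\big(M(C_{2n})\big)\,f\big(M(C_{2m})\big).$$
   Context: A distribution of pebbles on a graph assigns a nonnegative integer number of pebbles to each vertex. A pebbling move removes two pebbles from a vertex and places one pebble on an adjacent vertex. For a connected graph $G$ and a vertex $v$, $f(G,v)$ is the smallest integer $N$ such that from every distribution of $N$ pebbles on $G$ one pebble can be moved to $v$ by a sequence of pebbling moves; $f(G)=\max_{v\in V(G)} f(G,v)$. $C_k$ denotes the cycle on $k$ vertices. The middle graph $M(G)$ of a graph $G$ is obtained from $G$ by inserting a new vertex into each edge of $G$ (subdividing it), and joining two new vertices by an edge whenever the two edges of $G$ they were inserted into share a common endpoint; the original vertices of $G$ are vertices of $M(G)$. For graphs $G_1,G_2$, the Cartesian product $G_1\times G_2$ has vertex set $V(G_1)\times V(G_2)$, with $(u_1,v_1)$ adjacent to $(u_2,v_2)$ iff either $u_1=u_2$ and $v_1v_2\in E(G_2)$, or $u_1u_2\in E(G_1)$ and $v_1=v_2$. Thus a vertex $(u,v)$ of $M(C_{2n})\times M(C_{2m})$ lies outside $C_{2n}\times C_{2m}$ exactly when $u$ or $v$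 is one of the inserted (subdivision) vertices. *)

theory Defs
  imports "Graph_Theory.Pair_Digraph"
begin

text \<open>
  Finite simple graphs are \<^locale>\<open>pair_graph\<close>s: symmetric loop-free arc sets, an undirected
  edge between \<open>u\<close> and \<open>v\<close> being the two arcs \<open>(u, v)\<close> and \<open>(v, u)\<close>.
\<close>

definition edge_sets :: "'a pair_pre_digraph \<Rightarrow> 'a set set" where
  "edge_sets G = {{u, v} | u v. (u, v) \<in> parcs G}"

text \<open>A cycle in the usual sense only for \<open>k \<ge> 3\<close>.\<close>

definition cycle_graph :: "nat \<Rightarrow> nat pair_pre_digraph" where
  "cycle_graph k =
     \<lparr> pverts = {..<k},
       parcs = {(i, j). i < k \<and> j < k \<and> (j = Suc i mod k \<or> i = Suc j mod k)} \<rparr>"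

text \<open>\<open>Inl x\<close> is the original vertex \<open>x\<close>, \<open>Inr e\<close> the vertex inserted into the edge \<open>e\<close>.\<close>

definition middle_graph :: "'a pair_pre_digraph \<Rightarrow> ('a + 'a set) pair_pre_digraph" where
  "middle_graph G =
     \<lparr> pverts = Inl ` pverts G \<union> Inr ` edge_sets G,
       parcs = {(Inl x, Inr e) | x e. e \<in> edge_sets G \<and> x \<in> e}
             \<union> {(Inr e, Inl x) | x e. e \<in> edge_sets G \<and> x \<in> e}
             \<union> {(Inr e, Inr e') | e e'. e \<in> edge_sets G \<and> e' \<in> edge_sets G \<and>
                                         e \<noteq> e' \<and> e \<inter> e' \<noteq> {}} \<rparr>"

definition cart_prod ::
  "'a pair_pre_digraph \<Rightarrow> 'b pair_pre_digraph \<Rightarrow> ('a \<times> 'b) pair_pre_digraph" where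
  "cart_prod G H =
     \<lparr> pverts = pverts G \<times> pverts H,
       parcs = {((u1, v1), (u2, v2)) | u1 v1 u2 v2.
                  u1 = u2 \<and> u1 \<in> pverts G \<and> (v1, v2) \<in> parcs H \<or>
                  (u1, u2) \<in> parcs G \<and> v1 = v2 \<and> v1 \<in> pverts H} \<rparr>"

definition distribution :: "'a pair_pre_digraph \<Rightarrow> nat \<Rightarrow> ('a \<Rightarrow> nat) \<Rightarrow> bool" where
  "distribution G N p \<longleftrightarrow> (\<forall>x. x \<notin> pverts G \<longrightarrow> p x = 0) \<and> (\<Sum>x\<in>pverts G. p x) = N"

definition pebbling_move :: "'a pair_pre_digraph \<Rightarrow> ('a \<Rightarrow> nat) \<Rightarrow> ('a \<Rightarrow> nat) \<Rightarrow> bool" where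
  "pebbling_move G p q \<longleftrightarrow>
     (\<exists>x y. (x, y) \<in> parcs G \<and> 2 \<le> p x \<and> q = p(x := p x - 2, y := p y + 1))"

text \<open>The sequence of moves may be empty, so a pebble already lying on \<open>v\<close> counts.\<close>

definition can_reach :: "'a pair_pre_digraph \<Rightarrow> ('a \<Rightarrow> nat) \<Rightarrow> 'a \<Rightarrow> bool" where
  "can_reach G p v \<longleftrightarrow> (\<exists>q. (pebbling_move G)\<^sup>*\<^sup>* p q \<and> 1 \<le> q v)"

text \<open>For a finite connected \<open>G\<close> and \<open>v \<in> pverts G\<close> such an \<open>N\<close> exists.\<close>

definition pebbling_number_at :: "'a pair_pre_digraph \<Rightarrow> 'a \<Rightarrow> nat" where
  "pebbling_number_at G v = (LEAST N. \<forall>p. distribution G N p \<longrightarrow> can_reach G p v)"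

definition pebbling_number :: "'a pair_pre_digraph \<Rightarrow> nat" where
  "pebbling_number G = Max (pebbling_number_at G ` pverts G)"

lemma pair_graph_cycle_graph:
  assumes "3 \<le> k"
  shows "pair_graph (cycle_graph k)"
proof
  show "finite (parcs (cycle_graph k))"
    by (rule finite_subset[of _ "{..<k} \<times> {..<k}"]) (auto simp: cycle_graph_def)
  show "symmetric (with_proj (cycle_graph k))"
    by (auto simp: symmetric_def sym_def cycle_graph_def)
  have "Suc i mod k \<noteq> i" if "i < k" for i
    using assms that by (cases "Suc i = k") auto
  then show "fst e \<noteq> snd e" if "e \<in> parcs (cycle_graph k)" for e
    using that by (fastforce simp: cycle_graph_def)
qed (auto simp: cycle_graph_def)

lemma pair_graph_middle_graph:
  assumes "pair_graph G"
  shows "pair_graph (middle_graph G)"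
proof -
  interpret pair_graph G by fact
  have verts: "x \<in> pverts G" if "e \<in> edge_sets G" "x \<in> e" for x e
    using that by (auto simp: edge_sets_def dest: in_arcsD1 in_arcsD2)
  have "edge_sets G = (\<lambda>(u, v). {u, v}) ` parcs G"
    by (auto simp: edge_sets_def)
  then have fin: "finite (edge_sets G)"
    using pair_finite_arcs by simp
  show ?thesis
  proof
    show fv: "finite (pverts (middle_graph G))"
      using fin pair_finite_verts by (simp add: middle_graph_def)
    show "finite (parcs (middle_graph G))"
      by (rule finite_subset[OF _ finite_cartesian_product[OF fv fv]])
        (auto simp: middle_graph_def dest: verts)
    show "symmetric (with_proj (middle_graph G))"
      by (auto simp: symmetric_def sym_def middle_graph_def)
  qed (auto simp: middle_graph_def dest: verts)
qed

lemma pair_graph_cart_prod: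
  assumes "pair_graph G" "pair_graph H"
  shows "pair_graph (cart_prod G H)"
proof -
  interpret G: pair_graph G by fact
  interpret H: pair_graph H by fact
  have sG: "(v, u) \<in> parcs G" if "(u, v) \<in> parcs G" for u v
    using that G.pair_sym_arcs by (auto simp: symmetric_def sym_def)
  have sH: "(v, u) \<in> parcs H" if "(u, v) \<in> parcs H" for u v
    using that H.pair_sym_arcs by (auto simp: symmetric_def sym_def)
  show ?thesis
  proof
    show fv: "finite (pverts (cart_prod G H))"
      using G.pair_finite_verts H.pair_finite_verts by (simp add: cart_prod_def)
    show "finite (parcs (cart_prod G H))"
      by (rule finite_subset[OF _ finite_cartesian_product[OF fv fv]])
        (auto simp: cart_prod_def dest: G.in_arcsD1 G.in_arcsD2 H.in_arcsD1 H.in_arcsD2)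
    show "symmetric (with_proj (cart_prod G H))"
      by (auto simp: symmetric_def sym_def cart_prod_def dest: sG sH)
  qed (auto simp: cart_prod_def dest: G.in_arcsD1 G.in_arcsD2 H.in_arcsD1 H.in_arcsD2
        G.pair_no_loops H.pair_no_loops)
qed

end

theory Submission
  imports Defs
begin

text \<open>
  By symmetry let \<open>u\<close> be an inserted vertex of \<open>G = M(C\<^bsub>2n\<^esub>)\<close>. All vertices of \<open>G\<close> lie within
  distance \<open>n\<close> of \<open>u\<close>, while \<open>f(G) \<ge> 2\<^bsup>n+1\<^esup> + 2n - 2\<close> because original vertices can be at distance
  \<open>n + 1\<close>; this slack pays for crude strategies in the product with \<open>H = M(C\<^bsub>2m\<^esub>)\<close>. In \<open>H\<close>, weighted
  trees show that \<open>2\<^bsup>m+1\<^esup> c + 2m - 2\<close> pebbles suffice to put \<open>c\<close> of them on any vertex. If a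
  configuration on the product is unsolvable, then gathering the pebbles of every row over \<open>u\<close>
  along a breadth first tree of \<open>G\<close> bounds twice their number, except that the triangle opposite
  to \<open>u\<close> counts only once; gathering every column in the row of \<open>v\<close> first bounds the pebbles over
  that triangle. Together the two inequalities leave fewer than \<open>f(G) f(H)\<close> pebbles.
\<close>

section \<open>Gathering pebbles\<close>

abbreviation pebbles :: "'a pair_pre_digraph \<Rightarrow> ('a \<Rightarrow> nat) \<Rightarrow> nat" where
  "pebbles G p \<equiv> \<Sum>x\<in>pverts G. p x"

abbreviation reach :: "'a pair_pre_digraph \<Rightarrow> ('a \<Rightarrow> nat) \<Rightarrow> ('a \<Rightarrow> nat) \<Rightarrow> bool" where
  "reach G \<equiv> (pebbling_move G)\<^sup>*\<^sup>*"

definition can_gather :: "'a pair_pre_digraph \<Rightarrow> ('a \<Rightarrow> nat) \<Rightarrow> nat \<Rightarrow> 'a \<Rightarrow> bool" where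
  "can_gather G p c v \<longleftrightarrow> (\<exists>q. reach G p q \<and> c \<le> q v)"

definition gathers :: "'a pair_pre_digraph \<Rightarrow> nat \<Rightarrow> nat \<Rightarrow> 'a \<Rightarrow> bool" where
  "gathers G K L v \<longleftrightarrow> (\<forall>p c. K * c + L \<le> pebbles G p \<longrightarrow> can_gather G p c v)"

lemma can_reach_iff_can_gather: "can_reach G p v \<longleftrightarrow> can_gather G p 1 v"
  by (simp add: can_reach_def can_gather_def)

lemma can_gather_0: "can_gather G p 0 v"
  by (auto simp: can_gather_def)

lemma can_gather_le:
  assumes "can_gather G p c v" "c' \<le> c"
  shows "can_gather G p c' v"
  using assms unfolding can_gather_def by (meson order_trans)

lemma can_gather_if_reach:
  assumes "reach G p q" "can_gather G q c v"
  shows "can_gather G p c v"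
  using assms unfolding can_gather_def by (meson rtranclp_trans)

lemma (in pair_wf_digraph) reach_frame:
  assumes "reach G p q" "\<And>x. x \<in> pverts G \<Longrightarrow> p x + s x \<le> p' x"
  shows "\<exists>q'. reach G p' q' \<and> (\<forall>x\<in>pverts G. q x + s x \<le> q' x)"
  using assms(1)
proof (induction rule: rtranclp_induct)
  case (step q\<^sub>1 q\<^sub>2)
  then obtain q' where q': "reach G p' q'" "\<forall>x\<in>pverts G. q\<^sub>1 x + s x \<le> q' x"
    by blast
  obtain x y where arc: "(x, y) \<in> parcs G" "2 \<le> q\<^sub>1 x" "q\<^sub>2 = q\<^sub>1(x := q\<^sub>1 x - 2, y := q\<^sub>1 y + 1)"
    using step.hyps(2) by (auto simp: pebbling_move_def)
  have source: "q\<^sub>1 x + s x \<le> q' x"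
    using q'(2) in_arcsD1[OF arc(1)] by blast
  then have "pebbling_move G q' (q'(x := q' x - 2, y := q' y + 1))"
    unfolding pebbling_move_def using arc(1,2) by (intro exI[of _ x] exI[of _ y]) simp
  moreover have "\<forall>z\<in>pverts G. q\<^sub>2 z + s z \<le> (q'(x := q' x - 2, y := q' y + 1)) z"
    using q'(2) source arc(2) by (auto simp: arc(3))
  ultimately show ?case
    using q'(1) by (meson rtranclp.rtrancl_into_rtrancl)
qed (use assms(2) in blast)

lemma (in pair_wf_digraph) can_gather_mono:
  assumes "can_gather G p c v" "v \<in> pverts G" "\<And>x. x \<in> pverts G \<Longrightarrow> p x \<le> p' x"
  shows "can_gather G p' c v"
proof -
  from assms(1) obtain q where q: "reach G p q" "c \<le> q v"
    by (auto simp: can_gather_def)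
  have "\<exists>q'. reach G p' q' \<and> (\<forall>x\<in>pverts G. q x + 0 \<le> q' x)"
    using assms(3) by (intro reach_frame[OF q(1)]) simp
  then show ?thesis
    using q(2) assms(2) by (auto simp: can_gather_def intro: order_trans)
qed

definition push :: "'a \<Rightarrow> 'a \<Rightarrow> ('a \<Rightarrow> nat) \<Rightarrow> 'a \<Rightarrow> nat" where
  "push x y p = p(x := p x mod 2, y := p y + p x div 2)"

lemma (in pair_loopfree_digraph) reach_push:
  assumes "(x, y) \<in> parcs G"
  shows "reach G p (push x y p)"
proof -
  have "x \<noteq> y"
    using assms no_loops' by blast
  have "reach G p (p(x := p x - 2 * c, y := p y + c))" if "2 * c \<le> p x" for c
    using that
  proof (induction c)
    case (Suc c)
    let ?q = "p(x := p x - 2 * c, y := p y + c)"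
    have "pebbling_move G ?q (?q(x := ?q x - 2, y := ?q y + 1))"
      unfolding pebbling_move_def
      using assms \<open>x \<noteq> y\<close> Suc.prems by (intro exI[of _ x] exI[of _ y]) simp
    moreover have "?q(x := ?q x - 2, y := ?q y + 1) = p(x := p x - 2 * Suc c, y := p y + Suc c)"
      using \<open>x \<noteq> y\<close> by (auto simp: fun_eq_iff)
    moreover have "reach G p ?q"
      using Suc by (simp del: fun_upd_apply)
    ultimately show ?case
      by (metis (no_types, lifting) rtranclp.rtrancl_into_rtrancl)
  qed simp
  from this[of "p x div 2"] show ?thesis
    by (simp add: push_def minus_mult_div_eq_mod)
qed

lemma (in pair_digraph) can_gather_push:
  assumes "(x, y) \<in> parcs G" "can_gather G (p(y := 0)) c x"
  shows "can_gather G p (p y + c div 2) y"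
proof -
  from assms(2) obtain q where q: "reach G (p(y := 0)) q" "c \<le> q x"
    by (auto simp: can_gather_def)
  have "\<exists>q'. reach G p q' \<and> (\<forall>z\<in>pverts G. q z + (if z = y then p y else 0) \<le> q' z)"
    by (rule reach_frame[OF q(1)]) simp
  then obtain q' where q': "reach G p q'" "\<forall>z\<in>pverts G. q z + (if z = y then p y else 0) \<le> q' z"
    by blast
  have "reach G p (push x y q')"
    using q'(1) reach_push[OF assms(1), of q'] by simp
  moreover have "p y \<le> q' y" "c \<le> q' x"
    using q(2) q'(2)[rule_format, of y] q'(2)[rule_format, of x] in_arcsD1[OF assms(1)]
      in_arcsD2[OF assms(1)] by (auto split: if_splits)
  then have "p y + c div 2 \<le> push x y q' y"
    by (simp add: push_def add_mono div_le_mono)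
  ultimately show ?thesis
    unfolding can_gather_def by blast
qed

lemma weighted_sum_push:
  fixes w :: "'i \<Rightarrow> nat"
  assumes "finite X" "inj_on g X" "x \<in> X" "y \<in> X" "x \<noteq> y" "2 * w x \<le> w y"
  shows "(\<Sum>z\<in>X. w z * p (g z)) \<le> (\<Sum>z\<in>X - {x}. w z * push (g x) (g y) p (g z)) + w x"
proof -
  let ?c = "p (g x) div 2"
  have "w z * push (g x) (g y) p (g z) = w z * p (g z) + (if z = y then w y * ?c else 0)"
    if "z \<in> X - {x}" for z
  proof -
    have "g z \<noteq> g x" "g z = g y \<longleftrightarrow> z = y"
      using that assms(2-4) by (auto dest: inj_onD)
    then show ?thesis
      by (auto simp: push_def distrib_left)
  qed
  then have "(\<Sum>z\<in>X - {x}. w z * push (g x) (g y) p (g z)) =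
      (\<Sum>z\<in>X - {x}. w z * p (g z)) + w y * ?c"
    using assms(1,4,5) by (simp add: sum.distrib)
  moreover have "(\<Sum>z\<in>X. w z * p (g z)) = w x * p (g x) + (\<Sum>z\<in>X - {x}. w z * p (g z))"
    using assms(1,3) by (rule sum.remove)
  moreover have "w x * p (g x) \<le> w y * ?c + w x"
  proof -
    have "w x * p (g x) \<le> w x * (2 * ?c + 1)"
      by (rule mult_left_mono) auto
    also have "\<dots> \<le> w y * ?c + w x"
      using mult_right_mono[OF assms(6), of ?c] by (simp add: algebra_simps)
    finally show ?thesis .
  qed
  ultimately show ?thesis
    by simp
qed

text \<open>
  Hurlbert's weight function lemma for the tree with root \<open>r\<close> and parent map \<open>par\<close>: pushing a vertex
  of minimal weight, which is a leaf, into its parent loses at most the weight of one pebble.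
\<close>

lemma (in pair_loopfree_digraph) weight_function:
  fixes w :: "'i \<Rightarrow> nat"
  assumes "finite X" "r \<in> X" "inj_on g X" "\<And>z. z \<in> X \<Longrightarrow> 0 < w z"
    and "\<And>z. z \<in> X \<Longrightarrow> z \<noteq> r \<Longrightarrow>
           par z \<in> X \<and> (g z, g (par z)) \<in> parcs G \<and> 2 * w z \<le> w (par z)"
  shows "\<exists>c. can_gather G p c (g r) \<and> (\<Sum>z\<in>X. w z * p (g z)) + w r \<le> w r * c + (\<Sum>z\<in>X. w z)"
  using assms
proof (induction "card X" arbitrary: X p)
  case (Suc n)
  show ?case
  proof (cases "X = {r}")
    case True
    have "can_gather G p (p (g r)) (g r)"
      by (auto simp: can_gather_def)
    then show ?thesis
      using True by auto
  next
    case False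
    then have "X - {r} \<noteq> {}"
      using Suc.prems(2) by auto
    then obtain x where x: "x \<in> X" "x \<noteq> r" and min: "\<And>z. z \<in> X - {r} \<Longrightarrow> w x \<le> w z"
      using ex_is_arg_min_if_finite[of "X - {r}" w] Suc.prems(1)
      by (auto simp: is_arg_min_linorder)
    let ?y = "par x" and ?X = "X - {x}"
    have y: "?y \<in> X" "(g x, g ?y) \<in> parcs G" "2 * w x \<le> w ?y" "x \<noteq> ?y"
      using Suc.prems(5)[OF x] Suc.prems(4)[OF x(1)] by auto
    have "par z \<in> ?X" if z: "z \<in> ?X" "z \<noteq> r" for z
      using Suc.prems(4,5)[of z] min[of z] z by fastforce
    then have "\<exists>c. can_gather G (push (g x) (g ?y) p) c (g r) \<and>
        (\<Sum>z\<in>?X. w z * push (g x) (g ?y) p (g z)) + w r \<le> w r * c + (\<Sum>z\<in>?X. w z)"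
      using Suc.hyps(2) Suc.prems x
      by (intro Suc.hyps(1)) (auto simp: inj_on_diff)
    then obtain c where gathered: "can_gather G (push (g x) (g ?y) p) c (g r)"
      "(\<Sum>z\<in>?X. w z * push (g x) (g ?y) p (g z)) + w r \<le> w r * c + (\<Sum>z\<in>?X. w z)"
      by blast
    have "(\<Sum>z\<in>X. w z * p (g z)) + w r \<le> w r * c + (\<Sum>z\<in>X. w z)"
      using weighted_sum_push[OF Suc.prems(1,3) x(1) y(1,4,3), of p] gathered(2)
        sum.remove[OF Suc.prems(1) x(1), of w] by linarith
    then show ?thesis
      using can_gather_if_reach[OF reach_push[OF y(2)] gathered(1)] by blast
  qed
qed auto

section \<open>Pebbling numbers\<close>

lemma exists_subdistribution:
  assumes "finite (pverts G)" "N \<le> pebbles G p"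
  shows "\<exists>p'. distribution G N p' \<and> (\<forall>x\<in>pverts G. p' x \<le> p x)"
  using assms(2)
proof (induction N)
  case 0
  have "distribution G 0 (\<lambda>_. 0)"
    by (simp add: distribution_def)
  then show ?case
    by blast
next
  case (Suc N)
  then obtain p' where p': "distribution G N p'" "\<forall>x\<in>pverts G. p' x \<le> p x"
    by auto
  have "\<exists>x\<in>pverts G. p' x < p x"
  proof (rule ccontr)
    assume "\<not> ?thesis"
    then have "pebbles G p \<le> pebbles G p'"
      by (intro sum_mono) auto
    then show False
      using p'(1) Suc.prems by (simp add: distribution_def)
  qed
  then obtain x where x: "x \<in> pverts G" "p' x < p x"
    by blast
  have "pebbles G (p'(x := Suc (p' x))) = Suc (pebbles G p')"
    using sum.remove[OF assms(1) x(1), of p'] sum.remove[OF assms(1) x(1), of "p'(x := Suc (p' x))"]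
    by simp
  then have "distribution G (Suc N) (p'(x := Suc (p' x)))"
    using p'(1) x(1) by (auto simp: distribution_def)
  moreover have "\<forall>z\<in>pverts G. (p'(x := Suc (p' x))) z \<le> p z"
    using p'(2) x(2) by simp
  ultimately show ?case
    by blast
qed

lemma (in pair_fin_digraph) less_pebbling_number_at:
  assumes "v \<in> pverts G" "gathers G K L v" "distribution G N p" "\<not> can_reach G p v"
  shows "N < pebbling_number_at G v"
proof (rule ccontr)
  let ?solvable = "\<lambda>N. \<forall>p. distribution G N p \<longrightarrow> can_reach G p v"
  assume "\<not> ?thesis"
  then have "pebbling_number_at G v \<le> pebbles G p"
    using assms(3) by (simp add: distribution_def)
  then obtain p' where p': "distribution G (pebbling_number_at G v) p'" "\<forall>x\<in>pverts G. p' x \<le> p x"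
    using exists_subdistribution[OF pair_finite_verts] by blast
  have "?solvable (K * 1 + L)"
    using assms(2) by (auto simp: gathers_def distribution_def can_reach_iff_can_gather)
  then have "?solvable (pebbling_number_at G v)"
    unfolding pebbling_number_at_def by (rule LeastI)
  then have "can_gather G p' 1 v"
    using p'(1) by (simp add: can_reach_iff_can_gather)
  then have "can_gather G p 1 v"
    by (rule can_gather_mono) (use assms(1) p'(2) in auto)
  with assms(4) show False
    by (simp add: can_reach_iff_can_gather)
qed

lemma pebbling_number_at_le:
  assumes "\<And>p. distribution G N p \<Longrightarrow> can_reach G p v"
  shows "pebbling_number_at G v \<le> N"
  unfolding pebbling_number_at_def by (rule Least_le) (use assms in blast)

lemma (in pair_fin_digraph) pebbling_number_at_le_pebbling_number:
  assumes "v \<in> pverts G"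
  shows "pebbling_number_at G v \<le> pebbling_number G"
  unfolding pebbling_number_def using assms pair_finite_verts by simp

section \<open>Cartesian products\<close>

lemma reach_row:
  assumes "y \<in> pverts H" "reach G (\<lambda>x. P (x, y)) q"
  shows "reach (cart_prod G H) P (\<lambda>(x, y'). if y' = y then q x else P (x, y'))"
  using assms(2)
proof (induction rule: rtranclp_induct)
  case base
  have "(\<lambda>(x, y'). if y' = y then P (x, y) else P (x, y')) = P"
    by (auto simp: fun_eq_iff)
  then show ?case by simp
next
  case (step q q')
  let ?P = "\<lambda>q (x, y'). if y' = y then q x else P (x, y')"
  from step.hyps(2) obtain a b where "(a, b) \<in> parcs G" "2 \<le> q a"
    "q' = q(a := q a - 2, b := q b + 1)"
    by (auto simp: pebbling_move_def)
  then have "pebbling_move (cart_prod G H) (?P q) (?P q')"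
    unfolding pebbling_move_def using assms(1)
    by (intro exI[of _ "(a, y)"] exI[of _ "(b, y)"]) (auto simp: cart_prod_def fun_eq_iff)
  then show ?case by (rule rtranclp.rtrancl_into_rtrancl[OF step.IH])
qed

lemma reach_rows:
  assumes "finite Y" "Y \<subseteq> pverts H" "\<And>y. y \<in> Y \<Longrightarrow> reach G (\<lambda>x. P (x, y)) (q y)"
  shows "reach (cart_prod G H) P (\<lambda>(x, y). if y \<in> Y then q y x else P (x, y))"
  using assms
proof (induction Y rule: finite_induct)
  case empty
  have "(\<lambda>(x, y). P (x, y)) = P" by auto
  then show ?case by simp
next
  case (insert y Y)
  let ?P = "\<lambda>Y (x, y). if y \<in> Y then q y x else P (x, y)"
  have "reach G (\<lambda>x. ?P Y (x, y)) (q y)"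
    using insert by simp
  then have "reach (cart_prod G H) (?P Y) (\<lambda>(x, y'). if y' = y then q y x else ?P Y (x, y'))"
    using insert by (intro reach_row) auto
  also have "(\<lambda>(x, y'). if y' = y then q y x else ?P Y (x, y')) = ?P (insert y Y)"
    by (auto simp: fun_eq_iff)
  finally have "reach (cart_prod G H) (?P Y) (?P (insert y Y))" .
  moreover have "reach (cart_prod G H) P (?P Y)"
    using insert by simp
  ultimately show ?case
    by simp
qed

lemma reach_swap:
  assumes "reach (cart_prod G H) P Q"
  shows "reach (cart_prod H G) (P \<circ> prod.swap) (Q \<circ> prod.swap)"
  using assms
proof (induction rule: rtranclp_induct)
  case (step Q Q')
  from step.hyps(2) obtain a b c d where "((a, b), (c, d)) \<in> parcs (cart_prod G H)" "2 \<le> Q (a, b)"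
    "Q' = Q((a, b) := Q (a, b) - 2, (c, d) := Q (c, d) + 1)"
    unfolding pebbling_move_def by (metis surj_pair)
  then have "pebbling_move (cart_prod H G) (Q \<circ> prod.swap) (Q' \<circ> prod.swap)"
    unfolding pebbling_move_def
    by (intro exI[of _ "(b, a)"] exI[of _ "(d, c)"]) (auto simp: cart_prod_def fun_eq_iff)
  then show ?case by (rule rtranclp.rtrancl_into_rtrancl[OF step.IH])
qed simp

lemma can_gather_swap:
  "can_gather (cart_prod H G) (P \<circ> prod.swap) c (y, x) \<longleftrightarrow> can_gather (cart_prod G H) P c (x, y)"
proof
  assume "can_gather (cart_prod H G) (P \<circ> prod.swap) c (y, x)"
  then obtain Q where "reach (cart_prod H G) (P \<circ> prod.swap) Q" "c \<le> Q (y, x)"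
    by (auto simp: can_gather_def)
  then show "can_gather (cart_prod G H) P c (x, y)"
    using reach_swap[of H G "P \<circ> prod.swap" Q]
    by (auto simp: can_gather_def comp_assoc intro!: exI[of _ "Q \<circ> prod.swap"])
next
  assume "can_gather (cart_prod G H) P c (x, y)"
  then obtain Q where "reach (cart_prod G H) P Q" "c \<le> Q (x, y)"
    by (auto simp: can_gather_def)
  then show "can_gather (cart_prod H G) (P \<circ> prod.swap) c (y, x)"
    using reach_swap[of G H P Q] by (auto simp: can_gather_def intro!: exI[of _ "Q \<circ> prod.swap"])
qed

lemma distribution_swap:
  "distribution (cart_prod H G) N (P \<circ> prod.swap) \<longleftrightarrow> distribution (cart_prod G H) N P"
proof -
  have "pebbles (cart_prod H G) (P \<circ> prod.swap) = pebbles (cart_prod G H) P"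
    by (rule sum.reindex_bij_witness[where i = prod.swap and j = prod.swap])
      (auto simp: cart_prod_def)
  then show ?thesis
    by (auto simp: distribution_def cart_prod_def)
qed

lemma pebbling_number_at_swap:
  "pebbling_number_at (cart_prod H G) (y, x) = pebbling_number_at (cart_prod G H) (x, y)"
proof -
  have "(\<forall>P. distribution (cart_prod H G) N P \<longrightarrow> can_gather (cart_prod H G) P 1 (y, x)) \<longleftrightarrow>
      (\<forall>P. distribution (cart_prod H G) N (P \<circ> prod.swap) \<longrightarrow>
        can_gather (cart_prod H G) (P \<circ> prod.swap) 1 (y, x))" for N
    by (metis comp_assoc swap_comp_swap comp_id)
  then show ?thesis
    by (simp only: pebbling_number_at_def can_reach_iff_can_gather can_gather_swap
        distribution_swap)
qed

lemma can_gather_rows_then_column: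
  assumes "pair_fin_digraph H" "x \<in> pverts G" "y \<in> pverts H"
    and rows: "\<And>b. b \<in> pverts H \<Longrightarrow> can_gather G (\<lambda>a. P (a, b)) (c b) x"
    and column: "can_gather H c n y"
  shows "can_gather (cart_prod G H) P n (x, y)"
proof -
  interpret H: pair_fin_digraph H by fact
  have "\<forall>b. \<exists>q. b \<in> pverts H \<longrightarrow> reach G (\<lambda>a. P (a, b)) q \<and> c b \<le> q x"
    using rows by (auto simp: can_gather_def)
  from choice[OF this] obtain q where
    q: "\<And>b. b \<in> pverts H \<Longrightarrow> reach G (\<lambda>a. P (a, b)) (q b)"
    "\<And>b. b \<in> pverts H \<Longrightarrow> c b \<le> q b x"
    by blast
  let ?Q = "\<lambda>(a, b). if b \<in> pverts H then q b a else P (a, b)"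
  have "can_gather H (\<lambda>b. ?Q (x, b)) n y"
    by (rule H.can_gather_mono[OF column assms(3)]) (use q(2) in simp)
  then obtain q' where q': "reach H (\<lambda>b. ?Q (x, b)) q'" "n \<le> q' y"
    by (auto simp: can_gather_def)
  have "reach (cart_prod H G) (?Q \<circ> prod.swap)
      (\<lambda>(b, a). if a = x then q' b else (?Q \<circ> prod.swap) (b, a))"
    using q'(1) assms(2) by (intro reach_row) simp_all
  then have "can_gather (cart_prod H G) (?Q \<circ> prod.swap) n (y, x)"
    using q'(2) by (fastforce simp: can_gather_def)
  then have "can_gather (cart_prod G H) ?Q n (x, y)"
    by (simp only: can_gather_swap)
  moreover have "reach (cart_prod G H) P ?Q"
    using H.pair_finite_verts q(1) by (intro reach_rows) auto
  ultimately show ?thesis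
    by (rule can_gather_if_reach[rotated])
qed

lemma can_gather_columns_then_row:
  assumes "pair_fin_digraph G" "x \<in> pverts G" "y \<in> pverts H"
    and "\<And>a. a \<in> pverts G \<Longrightarrow> can_gather H (\<lambda>b. P (a, b)) (c a) y"
    and "can_gather G c n x"
  shows "can_gather (cart_prod G H) P n (x, y)"
proof -
  have "can_gather (cart_prod H G) (P \<circ> prod.swap) n (y, x)"
    using assms by (intro can_gather_rows_then_column) auto
  then show ?thesis
    by (simp only: can_gather_swap)
qed

section \<open>Middle graphs of cycles\<close>

text \<open>
  The shape of \<open>M(C\<^sub>k)\<close>: a cycle of inserted vertices \<open>E i\<close>, and original vertices \<open>V i\<close> joined to
  \<open>E (i - 1)\<close> and \<open>E i\<close>. Reading indices modulo \<open>k\<close> makes rotations and reflections available.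
\<close>

locale middle_cycle = pair_graph G for G :: "'a pair_pre_digraph" +
  fixes k :: nat and V E :: "int \<Rightarrow> 'a"
  assumes k_pos: "0 < k"
    and verts: "pverts G = range V \<union> range E"
    and V_eq_iff: "V i = V j \<longleftrightarrow> int k dvd i - j"
    and E_eq_iff: "E i = E j \<longleftrightarrow> int k dvd i - j"
    and V_neq_E: "V i \<noteq> E j"
    and arc_E_E: "(E i, E (i + 1)) \<in> parcs G"
    and arc_V_E: "(V i, E i) \<in> parcs G"
    and arc_V_add_1_E: "(V (i + 1), E i) \<in> parcs G"
begin

lemma E_in_verts: "E i \<in> pverts G"
  by (simp add: verts)

lemma middle_cycle_shift: "middle_cycle G k (\<lambda>i. V (c + i)) (\<lambda>i. E (c + i))"
proof
  have "range (\<lambda>i. f (c + i)) = range f" for f :: "int \<Rightarrow> 'a"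
    by (metis (no_types) surj_plus range_composition image_image)
  then show "pverts G = range (\<lambda>i. V (c + i)) \<union> range (\<lambda>i. E (c + i))"
    by (simp add: verts)
qed (use k_pos V_neq_E arc_E_E[of "c + _"] arc_V_E arc_V_add_1_E[of "c + _"] in
    \<open>simp_all add: V_eq_iff E_eq_iff add.assoc\<close>)

lemma middle_cycle_reflect: "middle_cycle G k (\<lambda>i. V (c - i)) (\<lambda>i. E (c - 1 - i))"
proof
  have "range (\<lambda>i. f (d - i)) = range f" for f :: "int \<Rightarrow> 'a" and d
    by (auto simp: image_iff) (metis diff_diff_eq2 add_diff_cancel_left')
  then show "pverts G = range (\<lambda>i. V (c - i)) \<union> range (\<lambda>i. E (c - 1 - i))"
    by (simp add: verts)
  show "(E (c - 1 - i), E (c - 1 - (i + 1))) \<in> parcs G" for i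
    using arcs_symmetric[OF arc_E_E[of "c - 1 - (i + 1)"]] by (simp add: algebra_simps)
  show "(V (c - i), E (c - 1 - i)) \<in> parcs G" for i
    using arc_V_add_1_E[of "c - 1 - i"] by simp
  show "(V (c - (i + 1)), E (c - 1 - i)) \<in> parcs G" for i
    using arc_V_E[of "c - 1 - i"] by (simp add: algebra_simps)
qed (use k_pos V_neq_E in \<open>simp_all add: V_eq_iff E_eq_iff dvd_diff_commute\<close>)

lemma inj_on_window: "inj_on V {a..<a + int k}" "inj_on E {a..<a + int k}"
proof -
  have "i = j" if "i \<in> {a..<a + int k}" "j \<in> {a..<a + int k}" "int k dvd i - j" for i j
  proof (rule ccontr)
    assume "i \<noteq> j"
    then have "int k \<le> \<bar>i - j\<bar>"
      using that(3) by (intro zdvd_imp_le) simp_all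
    then show False
      using that(1,2) by auto
  qed
  then show "inj_on V {a..<a + int k}" "inj_on E {a..<a + int k}"
    by (auto intro!: inj_onI simp: V_eq_iff E_eq_iff)
qed

lemma range_eq_image_window: "range V = V ` {a..<a + int k}" "range E = E ` {a..<a + int k}"
proof -
  have "a + (i - a) mod int k \<in> {a..<a + int k}" "int k dvd i - (a + (i - a) mod int k)" for i
    using k_pos dvd_minus_mod[of "int k" "i - a"] by (simp_all add: algebra_simps)
  then have "V i \<in> V ` {a..<a + int k}" "E i \<in> E ` {a..<a + int k}" for i
    by (metis V_eq_iff image_eqI, metis E_eq_iff image_eqI)
  then show "range V = V ` {a..<a + int k}" "range E = E ` {a..<a + int k}"
    by blast+
qed

lemma pebbles_eq_window_sums:
  "pebbles G p = (\<Sum>i\<in>{a..<a + int k}. p (V i)) + (\<Sum>i\<in>{b..<b + int k}. p (E i))"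
proof -
  have "V ` {a..<a + int k} \<inter> E ` {b..<b + int k} = {}"
    using V_neq_E by blast
  then show ?thesis
    unfolding verts range_eq_image_window(1)[of a] range_eq_image_window(2)[of b]
    by (simp add: sum.union_disjoint sum.reindex inj_on_window)
qed

lemma card_verts: "card (pverts G) = 2 * k"
  using pebbles_eq_window_sums[of "\<lambda>_. 1" 0 0] by simp

end

definition residue :: "nat \<Rightarrow> int \<Rightarrow> nat" where
  "residue k i = nat (i mod int k)"

definition cycle_edge :: "nat \<Rightarrow> int \<Rightarrow> nat set" where
  "cycle_edge k i = {residue k i, residue k (i + 1)}"

lemma residue_less: "0 < k \<Longrightarrow> residue k i < k"
  by (simp add: residue_def nat_less_iff)

lemma residue_of_nat: "x < k \<Longrightarrow> residue k (int x) = x"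
  by (simp add: residue_def)

lemma range_residue:
  assumes "0 < k"
  shows "range (residue k) = {..<k}"
proof (intro equalityI subsetI)
  fix x assume "x \<in> {..<k}"
  then show "x \<in> range (residue k)"
    using residue_of_nat[of x k] by (metis lessThan_iff rangeI)
qed (use residue_less[OF assms] in auto)

lemma residue_eq_iff:
  assumes "0 < k"
  shows "residue k i = residue k j \<longleftrightarrow> int k dvd i - j"
  using assms by (simp add: residue_def eq_nat_nat_iff mod_eq_dvd_iff)

lemma residue_add_1:
  assumes "0 < k"
  shows "residue k (i + 1) = Suc (residue k i) mod k"
proof -
  have "int (residue k (i + 1)) = (int (residue k i) + 1) mod int k"
    using assms by (simp add: residue_def mod_add_left_eq)
  also have "\<dots> = int (Suc (residue k i) mod k)"
    by (simp add: zmod_int add.commute)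
  finally show ?thesis by simp
qed

lemma edge_sets_cycle_graph:
  assumes "0 < k"
  shows "edge_sets (cycle_graph k) = range (cycle_edge k)"
proof (intro equalityI subsetI)
  fix e assume "e \<in> edge_sets (cycle_graph k)"
  then obtain x where "x < k" "e = {x, Suc x mod k}"
    by (auto simp: edge_sets_def cycle_graph_def doubleton_eq_iff)
  then have "e = cycle_edge k (int x)"
    using assms by (simp add: cycle_edge_def residue_add_1 residue_of_nat)
  then show "e \<in> range (cycle_edge k)" by blast
next
  fix e assume "e \<in> range (cycle_edge k)"
  then obtain i where "e = {residue k i, Suc (residue k i) mod k}"
    using assms by (auto simp: cycle_edge_def residue_add_1)
  then show "e \<in> edge_sets (cycle_graph k)"
    using residue_less[OF assms, of i] assms unfolding edge_sets_def cycle_graph_def by fastforce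
qed

lemma cycle_edge_eq_iff:
  assumes "3 \<le> k"
  shows "cycle_edge k i = cycle_edge k j \<longleftrightarrow> int k dvd i - j"
proof -
  have "cycle_edge k i = cycle_edge k j \<longleftrightarrow> residue k i = residue k j"
    using residue_less[of k i] residue_less[of k j] assms
    by (auto simp: cycle_edge_def doubleton_eq_iff residue_add_1 mod_Suc split: if_splits)
  then show ?thesis
    using assms by (simp add: residue_eq_iff)
qed

lemma middle_cycle_middle_graph:
  assumes "3 \<le> k"
  shows "middle_cycle (middle_graph (cycle_graph k)) k
    (\<lambda>i. Inl (residue k i)) (\<lambda>i. Inr (cycle_edge k i))"
proof -
  interpret pair_graph "middle_graph (cycle_graph k)"
    using assms by (intro pair_graph_middle_graph pair_graph_cycle_graph)
  have edges: "edge_sets (cycle_graph k) = range (cycle_edge k)"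
    using assms by (simp add: edge_sets_cycle_graph)
  show ?thesis
  proof
    show "pverts (middle_graph (cycle_graph k)) =
        range (\<lambda>i. Inl (residue k i)) \<union> range (\<lambda>i. Inr (cycle_edge k i))"
      using assms edges range_residue[of k]
      by (simp add: middle_graph_def image_image[symmetric]) (simp add: cycle_graph_def)
    fix i
    have "\<not> int k dvd i - (i + 1)"
      using assms by simp
    then have "cycle_edge k i \<noteq> cycle_edge k (i + 1)"
      using cycle_edge_eq_iff[OF assms] by blast
    moreover have "cycle_edge k i \<inter> cycle_edge k (i + 1) \<noteq> {}"
      by (simp add: cycle_edge_def)
    ultimately show
      "(Inr (cycle_edge k i), Inr (cycle_edge k (i + 1))) \<in> parcs (middle_graph (cycle_graph k))"
      by (simp add: middle_graph_def edges)
    have "residue k i \<in> cycle_edge k i" "residue k (i + 1) \<in> cycle_edge k i"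
      by (simp_all add: cycle_edge_def)
    then show "(Inl (residue k i), Inr (cycle_edge k i)) \<in> parcs (middle_graph (cycle_graph k))"
      "(Inl (residue k (i + 1)), Inr (cycle_edge k i)) \<in> parcs (middle_graph (cycle_graph k))"
      by (simp_all add: middle_graph_def edges)
  qed (use assms in \<open>simp_all add: residue_eq_iff cycle_edge_eq_iff\<close>)
qed

section \<open>Gathering pebbles on the middle graph of an even cycle\<close>

definition attach :: "int \<Rightarrow> int" where
  "attach i = (if 0 < i then i - 1 else i)"

lemma sum_spine_weights:
  assumes "l \<le> N" "h \<le> N"
  shows "(\<Sum>i = - int l..int h. 2 ^ (N - nat \<bar>i\<bar>)) + 2 ^ (N - l) + 2 ^ (N - h) =
    (3 :: nat) * 2 ^ N"
  using assms(2)
proof (induction h)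
  case 0
  show ?case
    using assms(1)
  proof (induction l)
    case (Suc l)
    have "{- int (Suc l)..int 0} = insert (- int (Suc l)) {- int l..int 0}"
      by auto
    moreover have "N - l = Suc (N - Suc l)"
      using Suc.prems by simp
    ultimately show ?case
      using Suc by (simp add: nat_add_distrib)
  qed simp
next
  case (Suc h)
  have "{- int l..int (Suc h)} = insert (int (Suc h)) {- int l..int h}"
    by auto
  moreover have "N - h = Suc (N - Suc h)"
    using Suc.prems by simp
  ultimately show ?case
    using Suc by (simp add: nat_add_distrib)
qed

text \<open>
  The tree is a caterpillar rooted at \<open>E 0\<close>: its spine is the path of the \<open>E i\<close> with \<open>-l \<le> i \<le> h\<close>,
  and a leaf \<open>V i\<close> with \<open>i \<in> J\<close> hangs from \<open>E (attach i)\<close>, its neighbour nearest to the root.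
\<close>

lemma (in middle_cycle) caterpillar_gather:
  fixes l h N :: nat
  assumes "l + h < k" "l \<le> N" "h \<le> N" "finite J" "inj_on V J"
    and leaves: "\<And>i. i \<in> J \<Longrightarrow>
      attach i \<in> {- int l..int h} \<and> 0 < a i \<and> 2 * a i \<le> 2 ^ (N - nat \<bar>attach i\<bar>)"
  shows "\<exists>c. can_gather G p c (E 0) \<and>
    (\<Sum>i\<in>J. a i * p (V i)) + (\<Sum>i = - int l..int h. 2 ^ (N - nat \<bar>i\<bar>) * p (E i)) +
      2 ^ (N - l) + 2 ^ (N - h) \<le> 2 ^ N * (c + 2) + (\<Sum>i\<in>J. a i)"
proof -
  let ?S = "{- int l..int h}" and ?g = "case_sum V E"
  let ?X = "J <+> ?S" and ?w = "case_sum a (\<lambda>i. 2 ^ (N - nat \<bar>i\<bar>))"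
  let ?par = "case_sum (\<lambda>i. Inr (attach i)) (\<lambda>i. Inr (i - sgn i))"
  have inj_E: "inj_on E ?S"
    using inj_on_window(2)[of "- int l"] by (rule inj_on_subset) (use assms(1) in auto)
  have inj: "inj_on ?g ?X"
    by (intro inj_onI)
      (auto simp: V_neq_E V_neq_E[symmetric] intro: inj_onD[OF inj_E] inj_onD[OF assms(5)])
  have leaf_arc: "(V i, E (attach i)) \<in> parcs G" for i
    using arc_V_E[of i] arc_V_add_1_E[of "i - 1"] by (simp add: attach_def)
  have spine_arc: "i - sgn i \<in> ?S \<and> (E i, E (i - sgn i)) \<in> parcs G \<and>
      2 * 2 ^ (N - nat \<bar>i\<bar>) \<le> (2 :: nat) ^ (N - nat \<bar>i - sgn i\<bar>)" if "i \<in> ?S" "i \<noteq> 0" for i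
  proof -
    have "N - nat \<bar>i - sgn i\<bar> = Suc (N - nat \<bar>i\<bar>)"
      using that assms(2,3) by (auto simp: sgn_if)
    then show ?thesis
      using that arc_E_E[of i] arcs_symmetric[OF arc_E_E[of "i - 1"]] by (auto simp: sgn_if)
  qed
  have "\<exists>c. can_gather G p c (?g (Inr 0)) \<and>
      (\<Sum>z\<in>?X. ?w z * p (?g z)) + ?w (Inr 0) \<le> ?w (Inr 0) * c + (\<Sum>z\<in>?X. ?w z)"
  proof (rule weight_function[where par = ?par, OF _ _ inj])
    fix z assume "z \<in> ?X" "z \<noteq> Inr 0"
    then show "?par z \<in> ?X \<and> (?g z, ?g (?par z)) \<in> parcs G \<and> 2 * ?w z \<le> ?w (?par z)"
      using leaves leaf_arc spine_arc by (cases z) auto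
  qed (use assms(4) leaves in auto)
  then show ?thesis
    using sum_spine_weights[OF assms(2,3)] assms(4) by (auto simp: sum.Plus distrib_left)
qed

locale even_middle_cycle = middle_cycle G "2 * n" V E
  for G :: "'a pair_pre_digraph" and n :: nat and V E :: "int \<Rightarrow> 'a" +
  assumes two_le_n: "2 \<le> n"
begin

lemma even_middle_cycle_shift: "even_middle_cycle G n (\<lambda>i. V (c + i)) (\<lambda>i. E (c + i))"
  by (intro even_middle_cycle.intro middle_cycle_shift even_middle_cycle_axioms.intro two_le_n)

lemma even_middle_cycle_reflect: "even_middle_cycle G n (\<lambda>i. V (c - i)) (\<lambda>i. E (c - 1 - i))"
  by (intro even_middle_cycle.intro middle_cycle_reflect even_middle_cycle_axioms.intro two_le_n)

definition opposite_triangle :: "('a \<Rightarrow> nat) \<Rightarrow> nat" where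
  "opposite_triangle p = p (V (int n)) + p (V (int n + 1)) + p (E (int n))"

lemma V_opposite: "V (- int n) = V (int n)" "V (1 - int n) = V (int n + 1)"
  and E_opposite: "E (- int n) = E (int n)"
  by (simp_all add: V_eq_iff E_eq_iff)

text \<open>
  The leaves \<open>V n\<close> and \<open>V (1 - n)\<close> of the breadth first tree hang from spine vertices of weight 2,
  so they cannot have weight \<open>t = 2\<close> like the other leaves.
\<close>

definition leaf_weight :: "nat \<Rightarrow> int \<Rightarrow> nat" where
  "leaf_weight t i = (if i = int n \<or> i = 1 - int n then 1 else t)"

lemma two_mult_leaf_weight_le:
  assumes "t \<le> 2" "i \<in> {1 - int n..int n}"
  shows "2 * leaf_weight t i \<le> 2 ^ (n - nat \<bar>attach i\<bar>)"
proof (cases "i = int n \<or> i = 1 - int n")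
  case True
  then have "n - nat \<bar>attach i\<bar> = 1"
    using two_le_n by (auto simp: attach_def)
  then show ?thesis
    using True by (simp add: leaf_weight_def)
next
  case False
  then have "2 \<le> n - nat \<bar>attach i\<bar>"
    using assms(2) two_le_n by (auto simp: attach_def)
  then have "(2 :: nat) ^ 2 \<le> 2 ^ (n - nat \<bar>attach i\<bar>)"
    by (rule power_increasing) simp
  then show ?thesis
    using False assms(1) by (simp add: leaf_weight_def)
qed

lemma mult_sum_eq_sum_leaf_weight:
  fixes f :: "int \<Rightarrow> nat"
  assumes "0 < t"
  shows "t * (\<Sum>i = 1 - int n..int n. f i) =
    (\<Sum>i = 1 - int n..int n. leaf_weight t i * f i) + (t - 1) * (f (int n) + f (1 - int n))"
proof -
  have "t * f i = leaf_weight t i * f i + ((if i = int n then (t - 1) * f i else 0) +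
      (if i = 1 - int n then (t - 1) * f i else 0))" for i
    using assms two_le_n by (cases t) (auto simp: leaf_weight_def)
  then have "(\<Sum>i = 1 - int n..int n. t * f i) =
      (\<Sum>i = 1 - int n..int n. leaf_weight t i * f i) +
      ((\<Sum>i = 1 - int n..int n. if i = int n then (t - 1) * f i else 0) +
       (\<Sum>i = 1 - int n..int n. if i = 1 - int n then (t - 1) * f i else 0))"
    by (simp only: sum.distrib)
  then show ?thesis
    using two_le_n by (simp add: distrib_left sum_distrib_left)
qed

lemma sum_leaf_weight:
  assumes "0 < t"
  shows "(\<Sum>i = 1 - int n..int n. leaf_weight t i) = t * (2 * n - 2) + 2"
proof -
  obtain s where "t = Suc s"
    using assms gr0_implies_Suc by blast
  moreover have "(\<Sum>i = 1 - int n..int n. 1) = Suc (Suc (2 * n - 2))"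
    using two_le_n by simp
  ultimately show ?thesis
    using mult_sum_eq_sum_leaf_weight[OF assms, of "\<lambda>_. 1"] by simp
qed

lemma mult_sum_le_sum_spine_weight:
  fixes f :: "int \<Rightarrow> nat"
  assumes "0 < t" "t \<le> 2"
  shows "t * (\<Sum>i = 1 - int n..int n. f i) \<le>
    (\<Sum>i = 1 - int n..int n. 2 ^ (n - nat \<bar>i\<bar>) * f i) + (t - 1) * f (int n)"
proof -
  have "t * f i \<le> 2 ^ (n - nat \<bar>i\<bar>) * f i + (if i = int n then (t - 1) * f i else 0)"
    if "i \<in> {1 - int n..int n}" for i
  proof (cases "i = int n")
    case True
    then show ?thesis
      using assms(1) by (cases t) auto
  next
    case False
    then have "(2 :: nat) ^ 1 \<le> 2 ^ (n - nat \<bar>i\<bar>)"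
      using that by (intro power_increasing) auto
    then show ?thesis
      using False assms(2) by simp
  qed
  then have "(\<Sum>i = 1 - int n..int n. t * f i) \<le> (\<Sum>i = 1 - int n..int n.
      2 ^ (n - nat \<bar>i\<bar>) * f i + (if i = int n then (t - 1) * f i else 0))"
    by (rule sum_mono)
  then show ?thesis
    using two_le_n by (simp add: sum.distrib sum_distrib_left)
qed

lemma breadth_first_gather:
  assumes "0 < t" "t \<le> 2"
  shows "\<exists>c. can_gather G p c (E 0) \<and> t * pebbles G p + 1 \<le>
    2 ^ n * c + (t - 1) * opposite_triangle p + (2 ^ (n + 1) + t * (2 * n - 2))"
proof -
  let ?W = "{1 - int n..int n}"
  have window_eq: "{- int (n - 1)..int n} = ?W" "{1 - int n..<1 - int n + int (2 * n)} = ?W"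
    using two_le_n by auto
  have "\<exists>c. can_gather G p c (E 0) \<and>
      (\<Sum>i\<in>?W. leaf_weight t i * p (V i)) +
        (\<Sum>i = - int (n - 1)..int n. 2 ^ (n - nat \<bar>i\<bar>) * p (E i)) +
        2 ^ (n - (n - 1)) + 2 ^ (n - n) \<le> 2 ^ n * (c + 2) + (\<Sum>i\<in>?W. leaf_weight t i)"
  proof (rule caterpillar_gather)
    show "inj_on V ?W"
      using inj_on_window(1)[of "1 - int n"] unfolding window_eq(2) .
    fix i assume "i \<in> ?W"
    then show "attach i \<in> {- int (n - 1)..int n} \<and> 0 < leaf_weight t i \<and>
        2 * leaf_weight t i \<le> 2 ^ (n - nat \<bar>attach i\<bar>)"
      using two_mult_leaf_weight_le assms unfolding window_eq(1)
      by (auto simp: attach_def leaf_weight_def)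
  qed (use two_le_n in auto)
  then obtain c where gathered: "can_gather G p c (E 0)"
    "(\<Sum>i\<in>?W. leaf_weight t i * p (V i)) + (\<Sum>i\<in>?W. 2 ^ (n - nat \<bar>i\<bar>) * p (E i)) + 1
      \<le> 2 ^ n * c + 2 ^ (n + 1) + t * (2 * n - 2)"
    using two_le_n unfolding window_eq(1) sum_leaf_weight[OF assms(1)] by (auto simp: distrib_left)
  moreover have "pebbles G p = (\<Sum>i\<in>?W. p (V i)) + (\<Sum>i\<in>?W. p (E i))"
    using pebbles_eq_window_sums[of p "1 - int n" "1 - int n"] unfolding window_eq(2) .
  ultimately have "t * pebbles G p + 1 \<le>
      2 ^ n * c + (t - 1) * opposite_triangle p + (2 ^ (n + 1) + t * (2 * n - 2))"
    using mult_sum_eq_sum_leaf_weight[OF assms(1), of "\<lambda>i. p (V i)"]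
      mult_sum_le_sum_spine_weight[OF assms, of "\<lambda>i. p (E i)"] V_opposite(2)
    by (simp add: opposite_triangle_def distrib_left)
  with gathered(1) show ?thesis by blast
qed

lemma gathers_E: "gathers G (2 ^ (n + 1)) (2 * n - 2) (E 0)"
  unfolding gathers_def
proof (intro allI impI)
  fix p c assume large: "2 ^ (n + 1) * c + (2 * n - 2) \<le> pebbles G p"
  obtain d where gathered: "can_gather G p d (E 0)"
    "pebbles G p + 1 \<le> 2 ^ n * d + (2 ^ (n + 1) + (2 * n - 2))"
    using breadth_first_gather[of 1 p] by auto
  have "2 ^ n * (2 * c) < 2 ^ n * (d + 2)"
    using large gathered(2) by (simp add: distrib_left)
  then have "2 * c < d + 2"
    by (simp only: mult_less_cancel1)
  then have "c \<le> d"
    by simp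
  with gathered(1) show "can_gather G p c (E 0)"
    by (rule can_gather_le)
qed

definition half_weight :: "('a \<Rightarrow> nat) \<Rightarrow> nat" where
  "half_weight p = p (V 0) + p (V (int n)) +
    2 * (\<Sum>i\<in>{0<..<int n}. p (V i)) + 2 * (\<Sum>i\<in>{0..<int n}. p (E i))"

lemma half_cycle_gather_at_E:
  "\<exists>c. can_gather G p c (E 0) \<and>
    p (V (int n)) + 2 * (\<Sum>i\<in>{0<..<int n}. p (V i)) + 2 * (\<Sum>i\<in>{0..<int n}. p (E i)) + 3
      \<le> 2 ^ n * (c + 1) + 2 * n"
proof -
  let ?J = "{1..int n}" and ?a = "\<lambda>i. if i = int n then 1 else 2 :: nat"
  have J_eq: "?J = insert (int n) {0<..<int n}"
    and spine_eq: "{- int 0..int (n - 1)} = {0..<int n}"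
    using two_le_n by auto
  have inj: "inj_on V ?J"
    using inj_on_window(1)[of 1] by (rule inj_on_subset) auto
  have "2 * ?a i \<le> 2 ^ (n - nat \<bar>attach i\<bar>)" if "i \<in> ?J" for i
  proof (cases "i = int n")
    case False
    then have "(2 :: nat) ^ 2 \<le> 2 ^ (n - nat \<bar>attach i\<bar>)"
      using that by (intro power_increasing) (auto simp: attach_def)
    then show ?thesis using False by simp
  qed (use two_le_n in \<open>simp add: attach_def nat_diff_distrib\<close>)
  then have "\<exists>c. can_gather G p c (E 0) \<and>
      (\<Sum>i\<in>?J. ?a i * p (V i)) + (\<Sum>i = - int 0..int (n - 1). 2 ^ (n - nat \<bar>i\<bar>) * p (E i)) +
        2 ^ (n - 0) + 2 ^ (n - (n - 1)) \<le> 2 ^ n * (c + 2) + (\<Sum>i\<in>?J. ?a i)"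
    using inj two_le_n by (intro caterpillar_gather) (auto simp: attach_def)
  then obtain c where gathered: "can_gather G p c (E 0)"
    "(\<Sum>i\<in>?J. ?a i * p (V i)) + (\<Sum>i\<in>{0..<int n}. 2 ^ (n - nat \<bar>i\<bar>) * p (E i)) + 2
      \<le> 2 ^ n * (c + 1) + (\<Sum>i\<in>?J. ?a i)"
    using two_le_n unfolding spine_eq by (auto simp: distrib_left)
  have leaves: "(\<Sum>i\<in>?J. ?a i * f i) = f (int n) + 2 * (\<Sum>i\<in>{0<..<int n}. f i)" for f
    using two_le_n unfolding J_eq sum_distrib_left by simp
  have "2 * (\<Sum>i\<in>{0..<int n}. p (E i)) \<le> (\<Sum>i\<in>{0..<int n}. 2 ^ (n - nat \<bar>i\<bar>) * p (E i))"
    unfolding sum_distrib_left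
  proof (rule sum_mono)
    fix i assume "i \<in> {0..<int n}"
    then have "(2 :: nat) ^ 1 \<le> 2 ^ (n - nat \<bar>i\<bar>)"
      by (intro power_increasing) auto
    then show "2 * p (E i) \<le> 2 ^ (n - nat \<bar>i\<bar>) * p (E i)"
      by simp
  qed
  moreover have "(\<Sum>i\<in>?J. ?a i) + 1 = 2 * n"
    using leaves[of "\<lambda>_. 1"] two_le_n by simp
  ultimately show ?thesis
    using gathered leaves[of "\<lambda>i. p (V i)"] by (intro exI[of _ c]) simp
qed

lemma half_cycle_gather_at_V:
  "\<exists>c. can_gather G p c (V 0) \<and> half_weight p + 3 \<le> 2 ^ (n + 1) * (c + 1) + 2 * n"
proof -
  let ?p = "p(V 0 := 0)"
  have "V i \<noteq> V 0" if "0 < i" "i \<le> int n" for i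
    using that two_le_n zdvd_imp_le[of "int (2 * n)" i] by (auto simp: V_eq_iff)
  then have outside: "?p (V (int n)) = p (V (int n))"
    "(\<Sum>i\<in>{0<..<int n}. ?p (V i)) = (\<Sum>i\<in>{0<..<int n}. p (V i))"
    "(\<Sum>i\<in>{0..<int n}. ?p (E i)) = (\<Sum>i\<in>{0..<int n}. p (E i))"
    using two_le_n V_neq_E[symmetric] by (auto intro!: sum.cong)
  obtain c where gathered: "can_gather G ?p c (E 0)" and
    "p (V (int n)) + 2 * (\<Sum>i\<in>{0<..<int n}. p (V i)) + 2 * (\<Sum>i\<in>{0..<int n}. p (E i)) + 3
      \<le> 2 ^ n * (c + 1) + 2 * n"
    using half_cycle_gather_at_E[of ?p] unfolding outside by blast
  moreover have "2 ^ n * (c + 1) \<le> 2 ^ n * (2 * (c div 2 + 1))"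
    by (intro mult_le_mono2) presburger
  then have "2 ^ n * (c + 1) \<le> 2 ^ (n + 1) * (c div 2 + 1)"
    by (simp only: power_add power_one_right mult.assoc)
  moreover have "p (V 0) \<le> 2 ^ (n + 1) * p (V 0)"
    by simp
  ultimately have "half_weight p + 3 \<le> 2 ^ (n + 1) * (p (V 0) + c div 2 + 1) + 2 * n"
    unfolding half_weight_def distrib_left by linarith
  moreover have "can_gather G p (p (V 0) + c div 2) (V 0)"
    by (rule can_gather_push[OF arcs_symmetric[OF arc_V_E] gathered])
  ultimately show ?thesis
    by (intro exI[of _ "p (V 0) + c div 2"] conjI)
qed

lemma half_weights_eq_pebbles:
  "half_weight p + even_middle_cycle.half_weight n (\<lambda>i. V (- i)) (\<lambda>i. E (- 1 - i)) p =
    2 * pebbles G p"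
proof -
  interpret reflection: even_middle_cycle G n "\<lambda>i. V (- i)" "\<lambda>i. E (- 1 - i)"
    using even_middle_cycle_reflect[of 0] by simp
  have reflect: "(\<Sum>i\<in>{- int n<..<0}. f i) = (\<Sum>i\<in>{0<..<int n}. f (- i))"
    "(\<Sum>i\<in>{- int n..<0}. f i) = (\<Sum>i\<in>{0..<int n}. f (- 1 - i))" for f :: "int \<Rightarrow> nat"
    by (rule sum.reindex_bij_witness[where i = uminus and j = uminus], auto)
      (rule sum.reindex_bij_witness[where i = "\<lambda>i. - 1 - i" and j = "\<lambda>i. - 1 - i"], auto)
  have "{- int n..<- int n + int (2 * n)} =
      insert (- int n) (insert 0 ({- int n<..<0} \<union> {0<..<int n}))"
    using two_le_n by auto
  then have sum_V: "(\<Sum>i\<in>{- int n..<- int n + int (2 * n)}. p (V i)) = p (V (int n)) + p (V 0) +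
      (\<Sum>i\<in>{0<..<int n}. p (V (- i))) + (\<Sum>i\<in>{0<..<int n}. p (V i))"
    using two_le_n V_opposite(1) by (simp add: sum.union_disjoint reflect)
  have "{- int n..<- int n + int (2 * n)} = {- int n..<0} \<union> {0..<int n}"
    by auto
  then have sum_E: "(\<Sum>i\<in>{- int n..<- int n + int (2 * n)}. p (E i)) =
      (\<Sum>i\<in>{0..<int n}. p (E (- 1 - i))) + (\<Sum>i\<in>{0..<int n}. p (E i))"
    by (simp add: sum.union_disjoint reflect)
  show ?thesis
    unfolding half_weight_def reflection.half_weight_def
      pebbles_eq_window_sums[of p "- int n" "- int n"] sum_V sum_E
    using V_opposite(1) by simp
qed

lemma gathers_V: "gathers G (2 ^ (n + 1)) (2 * n - 2) (V 0)"
  unfolding gathers_def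
proof (intro allI impI)
  fix p c assume large: "2 ^ (n + 1) * c + (2 * n - 2) \<le> pebbles G p"
  interpret reflection: even_middle_cycle G n "\<lambda>i. V (- i)" "\<lambda>i. E (- 1 - i)"
    using even_middle_cycle_reflect[of 0] by simp
  obtain d where gathered: "can_gather G p d (V 0)"
    "half_weight p + 3 \<le> 2 ^ (n + 1) * (d + 1) + 2 * n"
    using half_cycle_gather_at_V by blast
  obtain d' where gathered': "can_gather G p d' (V 0)"
    "reflection.half_weight p + 3 \<le> 2 ^ (n + 1) * (d' + 1) + 2 * n"
    using reflection.half_cycle_gather_at_V[of p] by auto
  have "2 ^ (n + 1) * (2 * c) < 2 ^ (n + 1) * (d + d' + 2)"
    using large gathered(2) gathered'(2) half_weights_eq_pebbles[of p] two_le_n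
    by (simp add: distrib_left)
  then have "2 * c < d + d' + 2"
    by (simp only: mult_less_cancel1)
  then have "c \<le> d \<or> c \<le> d'"
    by linarith
  then show "can_gather G p c (V 0)"
    using can_gather_le[OF gathered(1)] can_gather_le[OF gathered'(1)] by auto
qed

lemma gathers_verts:
  assumes "v \<in> pverts G"
  shows "gathers G (2 ^ (n + 1)) (2 * n - 2) v"
proof -
  obtain i where i: "v = V i \<or> v = E i"
    using assms verts by auto
  interpret shift: even_middle_cycle G n "\<lambda>j. V (i + j)" "\<lambda>j. E (i + j)"
    by (rule even_middle_cycle_shift)
  show ?thesis
    using i shift.gathers_V shift.gathers_E by auto
qed

lemma opposite_triangle_gather:
  "\<exists>c. can_gather G p c (E 0) \<and> opposite_triangle p + p (V (int n)) + p (E (int n))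
    \<le> 2 ^ (n + 1) * (c + 1) + 1"
proof -
  let ?J = "{int n, int n + 1}" and ?a = "\<lambda>i. if i = int n then 2 else 1 :: nat"
  have "inj_on V ?J"
    using inj_on_window(1)[of "int n"] by (rule inj_on_subset) (use two_le_n in auto)
  then have "\<exists>c. can_gather G p c (E 0) \<and>
      (\<Sum>i\<in>?J. ?a i * p (V i)) + (\<Sum>i = - int 0..int n. 2 ^ (n + 1 - nat \<bar>i\<bar>) * p (E i)) +
        2 ^ (n + 1 - 0) + 2 ^ (n + 1 - n) \<le> 2 ^ (n + 1) * (c + 2) + (\<Sum>i\<in>?J. ?a i)"
    using two_le_n
    by (intro caterpillar_gather) (auto simp: attach_def nat_diff_distrib nat_add_distrib)
  moreover have "2 * p (E (int n)) \<le> (\<Sum>i = - int 0..int n. 2 ^ (n + 1 - nat \<bar>i\<bar>) * p (E i))"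
    using member_le_sum[of "int n" "{- int 0..int n}" "\<lambda>i. 2 ^ (n + 1 - nat \<bar>i\<bar>) * p (E i)"] by simp
  ultimately show ?thesis
    by (auto simp: opposite_triangle_def distrib_left)
qed

lemma opposite_triangle_le_if_unsolvable:
  assumes "\<not> can_reach G p (E 0)"
  shows "3 * opposite_triangle p \<le> 2 ^ (n + 2) + 2"
proof -
  interpret reflection: even_middle_cycle G n "\<lambda>i. V (1 - i)" "\<lambda>i. E (- i)"
    using even_middle_cycle_reflect[of 1] by simp
  have unsolvable: "c = 0" if "can_gather G p c (E 0)" for c
    using assms can_gather_le[OF that, of 1] by (cases c) (auto simp: can_reach_iff_can_gather)
  have "opposite_triangle p + p (V (int n)) + p (E (int n)) \<le> 2 ^ (n + 1) + 1"
    using opposite_triangle_gather[of p] by (auto dest: unsolvable)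
  moreover have "opposite_triangle p + p (V (int n + 1)) + p (E (int n)) \<le> 2 ^ (n + 1) + 1"
    using reflection.opposite_triangle_gather[of p] V_opposite E_opposite
    by (auto simp: opposite_triangle_def reflection.opposite_triangle_def dest: unsolvable)
  ultimately show ?thesis
    by (simp add: opposite_triangle_def)
qed

end

section \<open>A lower bound for middle graphs\<close>

lemma (in pair_graph) potential_nonincreasing:
  fixes \<phi> :: "'a \<Rightarrow> nat \<Rightarrow> nat"
  assumes move: "\<And>x y a b. (x, y) \<in> parcs G \<Longrightarrow> 2 \<le> a \<Longrightarrow>
      \<phi> x (a - 2) + \<phi> y (b + 1) \<le> \<phi> x a + \<phi> y b"
    and "reach G p q"
  shows "(\<Sum>x\<in>pverts G. \<phi> x (q x)) \<le> (\<Sum>x\<in>pverts G. \<phi> x (p x))"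
  using assms(2)
proof (induction rule: rtranclp_induct)
  case (step q q')
  from step.hyps(2) obtain x y where arc: "(x, y) \<in> parcs G" "2 \<le> q x"
    "q' = q(x := q x - 2, y := q y + 1)"
    by (auto simp: pebbling_move_def)
  have "x \<in> pverts G" "y \<in> pverts G - {x}"
    using arc(1) in_arcsD1 in_arcsD2 no_loops' by fastforce+
  then have split: "(\<Sum>z\<in>pverts G. \<phi> z (r z)) =
      \<phi> x (r x) + (\<phi> y (r y) + (\<Sum>z\<in>pverts G - {x} - {y}. \<phi> z (r z)))" for r
    using pair_finite_verts by (simp add: sum.remove)
  have "(\<Sum>z\<in>pverts G - {x} - {y}. \<phi> z (q' z)) = (\<Sum>z\<in>pverts G - {x} - {y}. \<phi> z (q z))"
    by (rule sum.cong) (auto simp: arc(3))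
  moreover have "\<phi> x (q' x) + \<phi> y (q' y) \<le> \<phi> x (q x) + \<phi> y (q y)"
    using move[OF arc(1,2), of "q y"] \<open>y \<in> _\<close> by (auto simp: arc(3))
  ultimately show ?case
    using step.IH split[of q] split[of q'] by linarith
qed simp

text \<open>
  For a distance function \<open>\<delta>\<close>, a single pebble on an original vertex \<open>x\<close> with \<open>\<delta> x > 0\<close> is
  worthless, because the neighbours of \<open>x\<close> are pairwise adjacent; hence only pairs of pebbles on \<open>x\<close>
  count, each as much as one pebble on the best neighbour.
\<close>

definition middle_potential :: "('a \<Rightarrow> nat) \<Rightarrow> nat \<Rightarrow> 'a + 'a set \<Rightarrow> nat \<Rightarrow> nat" where
  "middle_potential \<delta> d z a = (case z of
      Inl x \<Rightarrow> if \<delta> x = 0 then 2 ^ (d + 1) * a else 2 ^ (d + 1 - \<delta> x) * (a div 2)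
    | Inr e \<Rightarrow> 2 ^ (d - Min (\<delta> ` e)) * a)"

lemma middle_potential_Inl_add_1:
  "middle_potential \<delta> d (Inl x) (b + 1) \<le> middle_potential \<delta> d (Inl x) b + 2 ^ (d + 1 - \<delta> x)"
proof (cases "\<delta> x = 0")
  case False
  have "(2 :: nat) ^ (d + 1 - \<delta> x) * ((b + 1) div 2) \<le> 2 ^ (d + 1 - \<delta> x) * (b div 2 + 1)"
    by (intro mult_le_mono2) presburger
  then show ?thesis
    using False by (simp add: middle_potential_def)
qed (simp add: middle_potential_def)

lemma middle_potential_Inl_minus_2:
  assumes "2 \<le> a"
  shows "middle_potential \<delta> d (Inl x) (a - 2) + 2 ^ (d + 1 - \<delta> x) \<le> middle_potential \<delta> d (Inl x) a"
proof -
  obtain b where "a = b + 2"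
    using assms by (metis add.commute le_Suc_ex)
  then show ?thesis
    by (simp add: middle_potential_def)
qed

lemma middle_potential_Inr_minus_2:
  assumes "2 \<le> a"
  shows "middle_potential \<delta> d (Inr e) (a - 2) + 2 ^ (d - Min (\<delta> ` e) + 1) =
    middle_potential \<delta> d (Inr e) a"
proof -
  obtain b where "a = b + 2"
    using assms by (metis add.commute le_Suc_ex)
  then show ?thesis
    by (simp add: middle_potential_def)
qed

lemma (in pair_graph) lipschitz_Min_edge:
  fixes \<delta> :: "'a \<Rightarrow> nat"
  assumes lipschitz: "\<And>x y. (x, y) \<in> parcs G \<Longrightarrow> \<delta> x \<le> \<delta> y + 1"
    and "e \<in> edge_sets G" "x \<in> e"
  shows "Min (\<delta> ` e) \<le> \<delta> x" "\<delta> x \<le> Min (\<delta> ` e) + 1"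
proof -
  from assms(2) obtain u v where e: "e = {u, v}" "(u, v) \<in> parcs G"
    by (auto simp: edge_sets_def)
  then show "Min (\<delta> ` e) \<le> \<delta> x" "\<delta> x \<le> Min (\<delta> ` e) + 1"
    using assms(3) lipschitz[OF e(2)] lipschitz[OF arcs_symmetric[OF e(2)]]
    by (auto simp: min_def)
qed

lemma (in pair_graph) middle_potential_move:
  assumes lipschitz: "\<And>x y. (x, y) \<in> parcs G \<Longrightarrow> \<delta> x \<le> \<delta> y + 1"
    and arc: "(y, z) \<in> parcs (middle_graph G)" and a: "2 \<le> a"
  shows "middle_potential \<delta> d y (a - 2) + middle_potential \<delta> d z (b + 1)
    \<le> middle_potential \<delta> d y a + middle_potential \<delta> d z b"
proof -
  have edge: "Min (\<delta> ` e) \<le> \<delta> x" "\<delta> x \<le> Min (\<delta> ` e) + 1" if "e \<in> edge_sets G" "x \<in> e" for e x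
    using lipschitz_Min_edge[of \<delta> e x] lipschitz that by blast+
  have Inr_add_1: "middle_potential \<delta> d (Inr e) (b + 1) =
      middle_potential \<delta> d (Inr e) b + 2 ^ (d - Min (\<delta> ` e))" for e
    by (simp add: middle_potential_def)
  consider x e where "y = Inl x" "z = Inr e" "e \<in> edge_sets G" "x \<in> e"
    | x e where "y = Inr e" "z = Inl x" "e \<in> edge_sets G" "x \<in> e"
    | e f x where "y = Inr e" "z = Inr f" "e \<in> edge_sets G" "f \<in> edge_sets G" "x \<in> e" "x \<in> f"
    using arc by (simp add: middle_graph_def) blast
  then show ?thesis
  proof cases
    case 1
    have "(2 :: nat) ^ (d - Min (\<delta> ` e)) \<le> 2 ^ (d + 1 - \<delta> x)"
      by (rule power_increasing) (use edge(2)[OF 1(3,4)] in auto)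
    then show ?thesis
      using middle_potential_Inl_minus_2[OF a, of \<delta> d x] unfolding 1(1,2) Inr_add_1 by linarith
  next
    case 2
    have "(2 :: nat) ^ (d + 1 - \<delta> x) \<le> 2 ^ (d - Min (\<delta> ` e) + 1)"
      by (rule power_increasing) (use edge(1)[OF 2(3,4)] in auto)
    then show ?thesis
      using middle_potential_Inl_add_1[of \<delta> d x b] middle_potential_Inr_minus_2[OF a, of \<delta> d e]
      unfolding 2(1,2) by linarith
  next
    case 3
    have "(2 :: nat) ^ (d - Min (\<delta> ` f)) \<le> 2 ^ (d - Min (\<delta> ` e) + 1)"
      by (rule power_increasing) (use edge(1)[OF 3(3,5)] edge(2)[OF 3(4,6)] in auto)
    then show ?thesis
      using middle_potential_Inr_minus_2[OF a, of \<delta> d e] unfolding 3(1,2) Inr_add_1 by linarith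
  qed
qed

lemma (in pair_graph) sum_verts_middle_graph:
  "(\<Sum>z\<in>pverts (middle_graph G). f z) =
    (\<Sum>x\<in>pverts G. f (Inl x)) + (\<Sum>e\<in>edge_sets G. f (Inr e))"
proof -
  interpret M: pair_graph "middle_graph G"
    by (rule pair_graph_middle_graph) unfold_locales
  have "pverts (middle_graph G) = pverts G <+> edge_sets G"
    by (simp add: middle_graph_def Plus_def)
  then show ?thesis
    using M.pair_finite_verts by (simp add: finite_Plus_iff sum.Plus)
qed

lemma (in pair_graph) middle_graph_unsolvable:
  assumes lipschitz: "\<And>x y. (x, y) \<in> parcs G \<Longrightarrow> \<delta> x \<le> \<delta> y + 1"
    and zero: "\<And>x. x \<in> pverts G \<Longrightarrow> \<delta> x = 0 \<longleftrightarrow> x = r"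
    and r: "r \<in> pverts G" and s: "s \<in> pverts G" "s \<noteq> r"
  shows "\<exists>p. distribution (middle_graph G) (2 ^ (\<delta> s + 1) - 1 + (card (pverts G) - 2)) p \<and>
    \<not> can_reach (middle_graph G) p (Inl r)"
proof -
  interpret M: pair_graph "middle_graph G"
    by (rule pair_graph_middle_graph) unfold_locales
  let ?\<phi> = "middle_potential \<delta> (\<delta> s)" and ?rest = "pverts G - {s} - {r}"
  define p :: "'a + 'a set \<Rightarrow> nat" where
    "p = case_sum (\<lambda>x. if x = s then 2 ^ (\<delta> s + 1) - 1 else of_bool (x \<in> ?rest)) (\<lambda>_. 0)"
  have split: "(\<Sum>x\<in>pverts G. f x) = f s + (f r + (\<Sum>x\<in>?rest. f x))" for f :: "'a \<Rightarrow> nat"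
    using sum.remove[OF pair_finite_verts s(1), of f] sum.remove[of "pverts G - {s}" r f]
      pair_finite_verts r s by simp
  have "pebbles (middle_graph G) p = 2 ^ (\<delta> s + 1) - 1 + card ?rest"
    using s(2) by (simp add: sum_verts_middle_graph split p_def)
  also have "card ?rest = card (pverts G) - 2"
    using r s pair_finite_verts by simp
  finally have "distribution (middle_graph G) (2 ^ (\<delta> s + 1) - 1 + (card (pverts G) - 2)) p"
    using s(1) by (auto simp: distribution_def p_def middle_graph_def split: sum.split)
  moreover have "\<not> can_reach (middle_graph G) p (Inl r)"
  proof
    assume "can_reach (middle_graph G) p (Inl r)"
    then obtain q where q: "reach (middle_graph G) p q" "1 \<le> q (Inl r)"
      by (auto simp: can_reach_def)
    have "2 ^ (\<delta> s + 1) \<le> ?\<phi> (Inl r) (q (Inl r))"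
      using q(2) zero[OF r] by (simp add: middle_potential_def)
    also have "\<dots> \<le> (\<Sum>z\<in>pverts (middle_graph G). ?\<phi> z (q z))"
      using M.pair_finite_verts r by (intro member_le_sum) (auto simp: middle_graph_def)
    also have "\<dots> \<le> (\<Sum>z\<in>pverts (middle_graph G). ?\<phi> z (p z))"
      using middle_potential_move[OF lipschitz] q(1) by (rule M.potential_nonincreasing)
    also have "\<dots> = ?\<phi> (Inl s) (2 ^ (\<delta> s + 1) - 1)"
      using s zero by (simp add: sum_verts_middle_graph split p_def middle_potential_def)
    also have "\<dots> = 2 * ((2 ^ (\<delta> s + 1) - 1) div 2)"
      using s zero[OF s(1)] by (simp add: middle_potential_def)
    also have "\<dots> < 2 ^ (\<delta> s + 1)"
      using times_div_less_eq_dividend[of 2 "2 ^ (\<delta> s + 1) - 1 :: nat"] by (simp add: le_less_trans)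
    finally show False by simp
  qed
  ultimately show ?thesis by blast
qed

lemma even_middle_cycle_middle_graph:
  assumes "2 \<le> n"
  shows "even_middle_cycle (middle_graph (cycle_graph (2 * n))) n
    (\<lambda>i. Inl (residue (2 * n) i)) (\<lambda>i. Inr (cycle_edge (2 * n) i))"
  using assms
  by (intro even_middle_cycle.intro middle_cycle_middle_graph even_middle_cycle_axioms.intro) auto

lemma pebbling_number_middle_even_cycle_ge:
  assumes "2 \<le> n"
  shows "2 ^ (n + 1) + (2 * n - 2) \<le> pebbling_number (middle_graph (cycle_graph (2 * n)))"
proof -
  let ?C = "cycle_graph (2 * n)" and ?\<delta> = "\<lambda>i. min i (2 * n - i)"
  interpret C: pair_graph ?C
    using assms by (intro pair_graph_cycle_graph) simp
  interpret even_middle_cycle "middle_graph ?C" n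
      "\<lambda>i. Inl (residue (2 * n) i)" "\<lambda>i. Inr (cycle_edge (2 * n) i)"
    by (rule even_middle_cycle_middle_graph) fact
  have "\<exists>p. distribution (middle_graph ?C) (2 ^ (?\<delta> n + 1) - 1 + (card (pverts ?C) - 2)) p \<and>
      \<not> can_reach (middle_graph ?C) p (Inl 0)"
  proof (rule C.middle_graph_unsolvable[where \<delta> = ?\<delta> and s = n])
    show "?\<delta> x \<le> ?\<delta> y + 1" if "(x, y) \<in> parcs ?C" for x y
      using that by (auto simp: cycle_graph_def mod_Suc split: if_splits)
  qed (use assms in \<open>auto simp: cycle_graph_def\<close>)
  moreover have zero: "Inl 0 \<in> pverts (middle_graph ?C)"
    using assms by (simp add: middle_graph_def cycle_graph_def)
  ultimately have "2 ^ (?\<delta> n + 1) - 1 + (card (pverts ?C) - 2)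
      < pebbling_number_at (middle_graph ?C) (Inl 0)"
    using less_pebbling_number_at[OF _ gathers_verts] by blast
  also have "\<dots> \<le> pebbling_number (middle_graph ?C)"
    using zero by (rule pebbling_number_at_le_pebbling_number)
  finally show ?thesis
    by (simp add: cycle_graph_def)
qed

section \<open>The product of two middle graphs\<close>

lemma row_gathers_less_if_unsolvable:
  assumes "pair_fin_digraph H" "x \<in> pverts G" "y \<in> pverts H" "gathers H K L y"
    and unsolvable: "\<not> can_reach (cart_prod G H) P (x, y)"
    and rows: "\<And>b. b \<in> pverts H \<Longrightarrow> can_gather G (\<lambda>a. P (a, b)) (c b) x"
  shows "pebbles H c < K + L"
proof (rule ccontr)
  assume "\<not> ?thesis"
  then have "can_gather H c 1 y"
    using assms(4) by (simp add: gathers_def)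
  then have "can_gather (cart_prod G H) P 1 (x, y)"
    using assms(1-3) rows by (intro can_gather_rows_then_column)
  with unsolvable show False
    by (simp add: can_reach_iff_can_gather)
qed

lemma column_gathers_unsolvable_if_unsolvable:
  assumes "pair_fin_digraph G" "x \<in> pverts G" "y \<in> pverts H" "gathers H K L y"
    and unsolvable: "\<not> can_reach (cart_prod G H) P (x, y)"
  shows "\<not> can_reach G (\<lambda>a. (pebbles H (\<lambda>b. P (a, b)) - L) div K) x"
proof
  let ?c = "\<lambda>a. (pebbles H (\<lambda>b. P (a, b)) - L) div K"
  assume "can_reach G ?c x"
  then have row: "can_gather G ?c 1 x"
    by (simp add: can_reach_iff_can_gather)
  have "can_gather H (\<lambda>b. P (a, b)) (?c a) y" for a
  proof (cases "L \<le> pebbles H (\<lambda>b. P (a, b))")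
    case True
    then have "K * ?c a + L \<le> pebbles H (\<lambda>b. P (a, b))"
      using times_div_less_eq_dividend[of K "pebbles H (\<lambda>b. P (a, b)) - L"] by linarith
    then show ?thesis
      using assms(4) by (simp add: gathers_def)
  qed (simp add: can_gather_0)
  then have "can_gather (cart_prod G H) P 1 (x, y)"
    using assms(1-3) row by (intro can_gather_columns_then_row)
  with unsolvable show False
    by (simp add: can_reach_iff_can_gather)
qed

lemma (in even_middle_cycle) two_mult_pebbles_cart_prod_le:
  assumes "pair_fin_digraph H" "v \<in> pverts H" "gathers H K L v"
    and unsolvable: "\<not> can_reach (cart_prod G H) P (E 0, v)"
  shows "2 * pebbles (cart_prod G H) P + card (pverts H) + 2 ^ n \<le> 2 ^ n * (K + L) +
    opposite_triangle (\<lambda>x. pebbles H (\<lambda>y. P (x, y))) +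
    card (pverts H) * (2 ^ (n + 1) + 2 * (2 * n - 2))"
proof -
  let ?R = "2 ^ (n + 1) + 2 * (2 * n - 2)"
  have "\<forall>y. \<exists>c. can_gather G (\<lambda>x. P (x, y)) c (E 0) \<and>
      2 * pebbles G (\<lambda>x. P (x, y)) + 1 \<le> 2 ^ n * c + opposite_triangle (\<lambda>x. P (x, y)) + ?R"
    using breadth_first_gather[of 2] by simp
  from choice[OF this] obtain c where gathered: "\<And>y. can_gather G (\<lambda>x. P (x, y)) (c y) (E 0)"
    "\<And>y. 2 * pebbles G (\<lambda>x. P (x, y)) + 1 \<le>
      2 ^ n * c y + opposite_triangle (\<lambda>x. P (x, y)) + ?R"
    by blast
  have "pebbles H c < K + L"
    using assms(1) E_in_verts assms(2,3) unsolvable gathered(1)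
    by (rule row_gathers_less_if_unsolvable)
  then have "2 ^ n * (pebbles H c + 1) \<le> 2 ^ n * (K + L)"
    by (intro mult_le_mono2) simp
  moreover have "pebbles (cart_prod G H) P = (\<Sum>y\<in>pverts H. pebbles G (\<lambda>x. P (x, y)))"
    unfolding sum.swap[of _ "pverts G" "pverts H"]
    by (simp add: cart_prod_def sum.cartesian_product)
  moreover have "opposite_triangle (\<lambda>x. pebbles H (\<lambda>y. P (x, y))) =
      (\<Sum>y\<in>pverts H. opposite_triangle (\<lambda>x. P (x, y)))"
    by (simp add: opposite_triangle_def sum.distrib)
  moreover have "(\<Sum>y\<in>pverts H. 2 * pebbles G (\<lambda>x. P (x, y)) + 1) \<le>
      (\<Sum>y\<in>pverts H. 2 ^ n * c y + opposite_triangle (\<lambda>x. P (x, y)) + ?R)"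
    by (rule sum_mono) (rule gathered(2))
  ultimately show ?thesis
    by (simp add: sum.distrib sum_Suc sum_distrib_left[symmetric])
qed

lemma (in even_middle_cycle) opposite_columns_le:
  assumes "v \<in> pverts H" "0 < K" "gathers H K L v"
    and unsolvable: "\<not> can_reach (cart_prod G H) P (E 0, v)"
  shows "3 * opposite_triangle (\<lambda>x. pebbles H (\<lambda>y. P (x, y))) + 9 \<le>
    K * (2 ^ (n + 2) + 2) + 9 * (K + L)"
proof -
  let ?f = "\<lambda>x. pebbles H (\<lambda>y. P (x, y))"
  let ?c = "\<lambda>x. (?f x - L) div K"
  have column: "?f x + 1 \<le> K * ?c x + (K + L)" for x
    using dividend_less_times_div[OF assms(2), of "?f x - L"] by linarith
  have "opposite_triangle ?f + 3 \<le> K * opposite_triangle ?c + 3 * (K + L)"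
    using column[of "V (int n)"] column[of "V (int n + 1)"] column[of "E (int n)"]
    by (simp add: opposite_triangle_def distrib_left)
  moreover have "3 * opposite_triangle ?c \<le> 2 ^ (n + 2) + 2"
    using column_gathers_unsolvable_if_unsolvable[OF _ E_in_verts assms(1,3) unsolvable]
      pair_fin_digraph_axioms
    by (intro opposite_triangle_le_if_unsolvable)
  then have "K * (3 * opposite_triangle ?c) \<le> K * (2 ^ (n + 2) + 2)"
    by (rule mult_le_mono2)
  ultimately show ?thesis
    by simp
qed

text \<open>
  For \<open>X = 2\<^sup>n\<close> and \<open>K = 2\<^bsup>m+1\<^esup>\<close>: three times the bound from the rows plus the bound from the columns
  stays below \<open>6 f(G) f(H)\<close>.
\<close>

lemma combined_bounds_less_product:
  fixes m n K X :: nat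
  assumes "2 \<le> m" "2 \<le> n" "4 * m \<le> K" "2 * n \<le> X"
  shows "3 * (X * (K + (2 * m - 2))) + 3 * (4 * m * (2 * X + 2 * (2 * n - 2))) +
      K * (4 * X + 2) + 9 * (K + (2 * m - 2))
    < 6 * ((2 * X + (2 * n - 2)) * (K + (2 * m - 2))) + 3 * (4 * m) + 3 * X + 9"
proof -
  from assms obtain a b k x where
    "m = a + 2" "n = b + 2" "K = 4 * (a + 2) + k" "X = 2 * (b + 2) + x"
    by (metis add.commute le_Suc_ex)
  then show ?thesis
    by (simp add: algebra_simps)
qed

lemma four_mult_le_power: "2 \<le> m \<Longrightarrow> 4 * m \<le> 2 ^ (m + 1)"
  by (induction m rule: dec_induct) auto

lemma can_reach_cart_prod_at_E:
  assumes "even_middle_cycle G n V E" "even_middle_cycle H m V' E'" "v \<in> pverts H"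
    and large: "(2 ^ (n + 1) + (2 * n - 2)) * (2 ^ (m + 1) + (2 * m - 2)) \<le>
      pebbles (cart_prod G H) P"
  shows "can_reach (cart_prod G H) P (E i, v)"
proof (rule ccontr)
  interpret G: even_middle_cycle G n "\<lambda>j. V (i + j)" "\<lambda>j. E (i + j)"
    by (rule even_middle_cycle.even_middle_cycle_shift) fact
  interpret H: even_middle_cycle H m V' E' by fact
  assume "\<not> ?thesis"
  then have unsolvable: "\<not> can_reach (cart_prod G H) P (E (i + 0), v)"
    by simp
  have "3 * (2 ^ n * (2 ^ (m + 1) + (2 * m - 2))) + 3 * (4 * m * (2 * 2 ^ n + 2 * (2 * n - 2))) +
      2 ^ (m + 1) * (4 * 2 ^ n + 2) + 9 * (2 ^ (m + 1) + (2 * m - 2))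
    < 6 * ((2 * 2 ^ n + (2 * n - 2)) * (2 ^ (m + 1) + (2 * m - 2))) + 3 * (4 * m) + 3 * 2 ^ n + 9"
    using four_mult_le_power[OF G.two_le_n] four_mult_le_power[OF H.two_le_n]
    by (intro combined_bounds_less_product G.two_le_n H.two_le_n) simp_all
  moreover have "2 * pebbles (cart_prod G H) P + 4 * m + 2 ^ n \<le>
      2 ^ n * (2 ^ (m + 1) + (2 * m - 2)) +
      G.opposite_triangle (\<lambda>x. pebbles H (\<lambda>y. P (x, y))) + 4 * m * (2 * 2 ^ n + 2 * (2 * n - 2))"
    using G.two_mult_pebbles_cart_prod_le[OF H.pair_fin_digraph_axioms assms(3)
        H.gathers_verts[OF assms(3)] unsolvable]
    by (simp add: H.card_verts)
  moreover have "3 * G.opposite_triangle (\<lambda>x. pebbles H (\<lambda>y. P (x, y))) + 9 \<le>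
      2 ^ (m + 1) * (4 * 2 ^ n + 2) + 9 * (2 ^ (m + 1) + (2 * m - 2))"
    using G.opposite_columns_le[OF assms(3) _ H.gathers_verts[OF assms(3)] unsolvable] by simp
  ultimately show False
    using large by simp
qed

lemma pebbling_number_at_inserted_vertex_le:
  assumes "2 \<le> n" "2 \<le> m" "Inr e \<in> pverts (middle_graph (cycle_graph (2 * n)))"
    "v \<in> pverts (middle_graph (cycle_graph (2 * m)))"
  shows "pebbling_number_at
      (cart_prod (middle_graph (cycle_graph (2 * n))) (middle_graph (cycle_graph (2 * m)))) (Inr e, v)
    \<le> pebbling_number (middle_graph (cycle_graph (2 * n))) *
      pebbling_number (middle_graph (cycle_graph (2 * m)))"
proof (rule pebbling_number_at_le)
  fix p
  let ?G = "middle_graph (cycle_graph (2 * n))" and ?H = "middle_graph (cycle_graph (2 * m))"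
  assume "distribution (cart_prod ?G ?H) (pebbling_number ?G * pebbling_number ?H) p"
  then have large: "(2 ^ (n + 1) + (2 * n - 2)) * (2 ^ (m + 1) + (2 * m - 2)) \<le>
      pebbles (cart_prod ?G ?H) p"
    using mult_le_mono[OF pebbling_number_middle_even_cycle_ge[OF assms(1)]
        pebbling_number_middle_even_cycle_ge[OF assms(2)]]
    by (simp add: distribution_def)
  obtain i where "e = cycle_edge (2 * n) i"
    using assms(1,3) by (auto simp: middle_graph_def edge_sets_cycle_graph)
  then show "can_reach (cart_prod ?G ?H) p (Inr e, v)"
    using can_reach_cart_prod_at_E[OF even_middle_cycle_middle_graph[OF assms(1)]
        even_middle_cycle_middle_graph[OF assms(2)] assms(4) large]
    by simp
qed

theorem theorem3p2:
  fixes n m :: nat and u v :: "nat + nat set"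
  assumes "2 \<le> n" and "2 \<le> m"
    and "(u, v) \<in> pverts (cart_prod (middle_graph (cycle_graph (2 * n)))
                                     (middle_graph (cycle_graph (2 * m))))"
    and "(u, v) \<notin> map_prod Inl Inl ` pverts (cart_prod (cycle_graph (2 * n)) (cycle_graph (2 * m)))"
  shows "pebbling_number_at
           (cart_prod (middle_graph (cycle_graph (2 * n))) (middle_graph (cycle_graph (2 * m)))) (u, v)
         \<le> pebbling_number (middle_graph (cycle_graph (2 * n))) *
           pebbling_number (middle_graph (cycle_graph (2 * m)))"
proof -
  have uv: "u \<in> pverts (middle_graph (cycle_graph (2 * n)))"
    "v \<in> pverts (middle_graph (cycle_graph (2 * m)))"
    using assms(3) by (simp_all add: cart_prod_def)
  then consider e where "u = Inr e" | e where "v = Inr e"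
    using assms(4) by (cases u; cases v) (auto simp: cart_prod_def middle_graph_def)
  then show ?thesis
  proof cases
    case (1 e)
    then show ?thesis
      using pebbling_number_at_inserted_vertex_le assms(1,2) uv by blast
  next
    case (2 e)
    then show ?thesis
      using pebbling_number_at_inserted_vertex_le[OF assms(2,1), of e u] uv
      by (subst pebbling_number_at_swap) (simp add: mult.commute)
  qed
qed

end
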